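(* Let $P$ be a finite bounded poset with set of atoms $\Lambda$. The following are equivalent: (1) $A^{**}=A$ for all antichains $A$ in $P$. (2) $P$ is isomorphic to a well-complemented subposet of a Boolean lattice. (3) $P$ satisfies: (i) for all $x,y\in P$, if $\Lambda(x)\subseteq\Lambda(y)$ then $x\le y$; and (ii) for all $x\in P$ there exists $y\in P$ with $\Lambda\setminus\Lambda(x)=\Lambda(y)$.
   Context: A poset is bounded if it has a unique bottom element $\hat 0$ and a unique top element $\hat 1$. $\Lambda$ is the set of atoms (elements covering $\hat 0$); for $x\in P$, $\Lambda(x)$ is the set of atoms below $x$. An antichain in $P$ is a nonempty subset $A\subseteq P$ with $\hat 0\notin A$ whose elements are pairwise incomparable. The blocker of an antichain $A$ is the antichain $A^*=\min\{x\in P:\Lambda(x)\cap\Lambda(a)\ne\emptyset\text{ for every }a\in A\}$, where $\min E$ denotes the set of minimal elements of $E$. For a finite set $V$, a subposet of the Boolean lattice $\mathbf 2^V$ induced by a family $\mathcal S\subseteq\mathbf 2^V$ is well-complemented if (i) the empty set and all singletons belong to $\mathcal S$, and (ii) $\mathcal S$ is closed under taking complements in $V$. *)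

theory Defs
  imports "HOL-Algebra.Order"
begin

locale finite_bounded_poset =
  partial_order P + weak_partial_order_bottom P + weak_partial_order_top P
  for P (structure) +
  assumes finite_carrier: "finite (carrier P)"

text \<open>\<open>covers P x y\<close> reads: \<open>y\<close> covers \<open>x\<close>.\<close>

definition covers :: "('a, 'b) gorder_scheme \<Rightarrow> 'a \<Rightarrow> 'a \<Rightarrow> bool" where
  "covers P x y \<longleftrightarrow> x \<in> carrier P \<and> y \<in> carrier P \<and> x \<sqsubset>\<^bsub>P\<^esub> y \<and>
     \<not> (\<exists>z\<in>carrier P. x \<sqsubset>\<^bsub>P\<^esub> z \<and> z \<sqsubset>\<^bsub>P\<^esub> y)"

definition atoms :: "('a, 'b) gorder_scheme \<Rightarrow> 'a set" where
  "atoms P = {a. covers P \<bottom>\<^bsub>P\<^esub> a}"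

definition atoms_below :: "('a, 'b) gorder_scheme \<Rightarrow> 'a \<Rightarrow> 'a set" where
  "atoms_below P x = {a \<in> atoms P. a \<sqsubseteq>\<^bsub>P\<^esub> x}"

definition antichain :: "('a, 'b) gorder_scheme \<Rightarrow> 'a set \<Rightarrow> bool" where
  "antichain P A \<longleftrightarrow> A \<subseteq> carrier P \<and> A \<noteq> {} \<and> \<bottom>\<^bsub>P\<^esub> \<notin> A \<and>
     (\<forall>x\<in>A. \<forall>y\<in>A. x \<noteq> y \<longrightarrow> \<not> x \<sqsubseteq>\<^bsub>P\<^esub> y \<and> \<not> y \<sqsubseteq>\<^bsub>P\<^esub> x)"

definition minimal_elements :: "('a, 'b) gorder_scheme \<Rightarrow> 'a set \<Rightarrow> 'a set" where
  "minimal_elements P E = {x \<in> E. \<not> (\<exists>y\<in>E. y \<sqsubset>\<^bsub>P\<^esub> x)}"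

definition blocker :: "('a, 'b) gorder_scheme \<Rightarrow> 'a set \<Rightarrow> 'a set" where
  "blocker P A = minimal_elements P
     {x \<in> carrier P. \<forall>a\<in>A. atoms_below P x \<inter> atoms_below P a \<noteq> {}}"

definition boolean_lattice :: "'v set \<Rightarrow> 'v set gorder" where
  "boolean_lattice V = \<lparr>carrier = Pow V, eq = (=), le = (\<subseteq>)\<rparr>"

definition induced_subposet :: "('a, 'b) gorder_scheme \<Rightarrow> 'a set \<Rightarrow> ('a, 'b) gorder_scheme" where
  "induced_subposet P S = P\<lparr>carrier := S\<rparr>"

definition well_complemented :: "'v set \<Rightarrow> 'v set set \<Rightarrow> bool" where
  "well_complemented V S \<longleftrightarrow> S \<subseteq> Pow V \<and>
     {} \<in> S \<and> (\<forall>v\<in>V. {v} \<in> S) \<and> (\<forall>s\<in>S. V - s \<in> S)"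

definition order_isomorphic :: "('a, 'c) gorder_scheme \<Rightarrow> ('b, 'd) gorder_scheme \<Rightarrow> bool" where
  "order_isomorphic P Q \<longleftrightarrow>
     (\<exists>f. bij_betw f (carrier P) (carrier Q) \<and> order_emb P Q f)"

text \<open>
  HOL has no quantification over types inside a formula, so the finite ground set \<open>V\<close>
  is taken among the finite sets of natural numbers.  This loses no generality: by
  \<open>iso_to_well_complementedI\<close> below, a ground set of any other type serves as well.
\<close>

definition iso_to_well_complemented :: "('a, 'b) gorder_scheme \<Rightarrow> bool" where
  "iso_to_well_complemented P \<longleftrightarrow>
     (\<exists>(V :: nat set) S. finite V \<and> well_complemented V S \<and>
        order_isomorphic P (induced_subposet (boolean_lattice V) S))"

lemma weak_partial_order_boolean_subposet:
  "weak_partial_order (induced_subposet (boolean_lattice V) S)"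
  by unfold_locales (auto simp: induced_subposet_def boolean_lattice_def)

lemma iso_to_well_complementedI:
  fixes V :: "'v set"
  assumes "finite V" "well_complemented V S"
    and "order_isomorphic P (induced_subposet (boolean_lattice V) S)"
  shows "iso_to_well_complemented P"
proof -
  obtain g :: "'v \<Rightarrow> nat" where g: "inj_on g V"
    using assms(1) finite_imp_inj_to_nat_seg by blast
  obtain f where f: "bij_betw f (carrier P) S"
    and emb: "order_emb P (induced_subposet (boolean_lattice V) S) f"
    using assms(3) by (auto simp: order_isomorphic_def induced_subposet_def)
  have SV: "S \<subseteq> Pow V"
    using assms(2) by (simp add: well_complemented_def)
  have inj: "inj_on ((`) g) S"
    using SV g inj_on_image_Pow inj_on_subset by blast
  have "well_complemented (g ` V) ((`) g ` S)"
    unfolding well_complemented_def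
  proof (intro conjI ballI)
    show "(`) g ` S \<subseteq> Pow (g ` V)" using SV by auto
    show "{} \<in> (`) g ` S" using assms(2) by (auto simp: well_complemented_def)
    fix v assume "v \<in> g ` V"
    then obtain u where "u \<in> V" "v = g u" by blast
    then have "{v} = g ` {u}" "{u} \<in> S"
      using assms(2) by (auto simp: well_complemented_def)
    then show "{v} \<in> (`) g ` S" by blast
  next
    fix t assume "t \<in> (`) g ` S"
    then obtain s where s: "s \<in> S" "t = g ` s" by blast
    then have "s \<subseteq> V" using SV by blast
    then have "g ` V - t = g ` (V - s)"
      using g s(2) by (simp add: inj_on_image_set_diff)
    moreover have "V - s \<in> S" using assms(2) s(1) by (simp add: well_complemented_def)
    ultimately show "g ` V - t \<in> (`) g ` S" by blast
  qed
  moreover have "bij_betw ((`) g \<circ> f) (carrier P) ((`) g ` S)"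
    using f inj by (meson bij_betw_trans inj_on_imp_bij_betw)
  moreover have "order_emb P (induced_subposet (boolean_lattice (g ` V)) ((`) g ` S)) ((`) g \<circ> f)"
  proof -
    have "f x \<subseteq> V" if "x \<in> carrier P" for x
      using that f SV bij_betwE by blast
    then have "g ` f x \<subseteq> g ` f y \<longleftrightarrow> f x \<subseteq> f y" if "x \<in> carrier P" "y \<in> carrier P" for x y
      using that g by (metis image_mono inv_into_image_cancel)
    then show ?thesis
      using emb weak_partial_order_boolean_subposet
      by (simp add: order_emb_def) (simp add: induced_subposet_def boolean_lattice_def)
  qed
  ultimately show ?thesis
    using assms(1) unfolding iso_to_well_complemented_def order_isomorphic_def
    by (intro exI[of _ "g ` V"] exI[of _ "(`) g ` S"])
       (auto simp: induced_subposet_def boolean_lattice_def)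
qed

end

theory Submission
  imports Defs
begin

text \<open>
  Let \<open>E(A)\<close> be the set of elements sharing an atom with every member of \<open>A\<close>, so that
  \<open>A\<^sup>* = min E(A)\<close>.  Given (3), \<open>E(A\<^sup>*)\<close> is the up-closure of \<open>A\<close>: if \<open>x\<close> lies above no member
  of \<open>A\<close>, then the element with atom set \<open>\<Lambda> \<setminus> \<Lambda>(x)\<close> is in \<open>E(A)\<close>, and a member of \<open>A\<^sup>*\<close> below it
  shares no atom with \<open>x\<close>.  Hence \<open>A\<^sup>*\<^sup>* = A\<close>.

  Given (1), part (i) of (3) results from the antichain \<open>{x}\<close>, whose blocker is \<open>\<Lambda>(x)\<close>, and
  part (ii) from the antichain \<open>A = \<Lambda> \<setminus> \<Lambda>(x)\<close>: since \<open>x\<close> is above no member of \<open>A = A\<^sup>*\<^sup>*\<close>, some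
  \<open>y \<in> A\<^sup>*\<close> shares no atom with \<open>x\<close>, while \<open>A \<subseteq> \<Lambda>(y)\<close>.

  For (2), the map \<open>x \<mapsto> \<Lambda>(x)\<close> is the required embedding; conversely the
  singletons are the atoms of a well-complemented subposet.
\<close>

context finite_bounded_poset
begin

section \<open>Atoms and minimal elements\<close>

lemma mem_atoms:
  "a \<in> atoms P \<longleftrightarrow> a \<in> carrier P \<and> a \<noteq> \<bottom> \<and>
     (\<forall>z\<in>carrier P. z \<sqsubseteq> a \<longrightarrow> z = \<bottom> \<or> z = a)"
  unfolding atoms_def covers_def lless_eq by auto

lemma atoms_below_atom: "a \<in> atoms P \<Longrightarrow> atoms_below P a = {a}"
  unfolding atoms_below_def mem_atoms by auto

lemma atoms_below_bottom: "atoms_below P \<bottom> = {}"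
  unfolding atoms_below_def mem_atoms by (auto dest: le_antisym)

lemma atoms_below_mono:
  "\<lbrakk>x \<sqsubseteq> y; x \<in> carrier P; y \<in> carrier P\<rbrakk> \<Longrightarrow> atoms_below P x \<subseteq> atoms_below P y"
  unfolding atoms_below_def mem_atoms by (auto intro: le_trans)

lemma minimal_element_below:
  assumes "E \<subseteq> carrier P" "x \<in> E"
  shows "\<exists>m\<in>minimal_elements P E. m \<sqsubseteq> x"
proof -
  \<comment> \<open>An element of \<open>E\<close> below a member of \<open>?D\<close> is again in
    \<open>?D\<close>, so minimality in the finite set \<open>?D\<close> is minimality in
    \<open>E\<close>.\<close>
  let ?D = "{y \<in> E. y \<sqsubseteq> x}"
  have "finite ?D" using assms(1) finite_carrier finite_subset by fastforce
  moreover have "asymp_on ?D (\<sqsubset>)"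
    using assms(1) by (auto simp: asymp_on_def lless_eq dest: le_antisym)
  moreover have "transp_on ?D (\<sqsubset>)"
    using assms(1) by (auto intro!: transp_onI intro: lless_trans)
  moreover have "?D \<noteq> {}" using assms le_refl by blast
  ultimately obtain m where m: "m \<in> ?D" "\<forall>y\<in>?D. y \<noteq> m \<longrightarrow> \<not> y \<sqsubset> m"
    using Finite_Set.bex_min_element by (metis (no_types, lifting))
  have "\<not> y \<sqsubset> m" if "y \<in> E" for y
  proof
    assume "y \<sqsubset> m"
    then have "y \<sqsubseteq> m" "y \<noteq> m" by (simp_all add: lless_eq)
    moreover have "y \<sqsubseteq> x" using \<open>y \<sqsubseteq> m\<close> that m(1) assms by (auto intro: le_trans)
    ultimately show False using m(2) that \<open>y \<sqsubset> m\<close> by auto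
  qed
  then show ?thesis using m(1) by (auto simp: minimal_elements_def)
qed

text \<open>An element \<open>y\<close> of \<open>E\<close> strictly below some \<open>b\<close> in
  \<open>B\<close> would lie above some \<open>c\<close> in \<open>B\<close>; then
  \<open>c \<sqsubseteq> b\<close> forces \<open>c = b\<close>, and so \<open>y = b\<close>. The
  blocker of a singleton and the double blocker are both computed this way.\<close>

lemma minimal_elements_eqI:
  assumes "E \<subseteq> carrier P" "B \<subseteq> E"
    and below: "\<And>x. x \<in> E \<Longrightarrow> \<exists>b\<in>B. b \<sqsubseteq> x"
    and anti: "\<And>b c. \<lbrakk>b \<in> B; c \<in> B; b \<sqsubseteq> c\<rbrakk> \<Longrightarrow> b = c"
  shows "minimal_elements P E = B"
proof
  show "minimal_elements P E \<subseteq> B"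
    using assms(2) below unfolding minimal_elements_def lless_eq by blast
  show "B \<subseteq> minimal_elements P E"
  proof
    fix b assume b: "b \<in> B"
    have False if "y \<in> E" "y \<sqsubset> b" for y
    proof -
      have y: "y \<sqsubseteq> b" "y \<noteq> b" using that(2) by (simp_all add: lless_eq)
      obtain c where c: "c \<in> B" "c \<sqsubseteq> y" using below \<open>y \<in> E\<close> by blast
      have carr: "b \<in> carrier P" "c \<in> carrier P" "y \<in> carrier P"
        using assms(1,2) b c(1) that(1) by auto
      have "c \<sqsubseteq> b" using le_trans[OF c(2) y(1)] carr by blast
      then have "c = b" using anti b c(1) by blast
      then show False using y c(2) carr le_antisym by blast
    qed
    then show "b \<in> minimal_elements P E"
      using b assms(2) by (auto simp: minimal_elements_def)
  qed
qed

section \<open>Blockers\<close>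

lemma antichain_atoms:
  assumes "B \<subseteq> atoms P" "B \<noteq> {}"
  shows "antichain P B"
  using assms unfolding antichain_def by (auto simp: subset_iff mem_atoms)

text \<open>Sharing an atom with \<open>x\<close> means lying above an atom that is below
  \<open>x\<close>, and distinct atoms are incomparable. For \<open>x = \<bottom>\<close> both sides
  are empty.\<close>

lemma blocker_singleton:
  assumes x: "x \<in> carrier P"
  shows "blocker P {x} = atoms_below P x"
  unfolding blocker_def
proof (rule minimal_elements_eqI)
  show "atoms_below P x \<subseteq> {y \<in> carrier P. \<forall>a\<in>{x}. atoms_below P y \<inter> atoms_below P a \<noteq> {}}"
  proof
    fix a assume a: "a \<in> atoms_below P x"
    then have "a \<in> atoms P" by (simp add: atoms_below_def)
    then show "a \<in> {y \<in> carrier P. \<forall>a\<in>{x}. atoms_below P y \<inter> atoms_below P a \<noteq> {}}"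
      using a by (simp add: atoms_below_atom) (simp add: mem_atoms)
  qed
qed (auto simp: atoms_below_def mem_atoms)

text \<open>The only atom below an atom is that atom itself, so sharing an atom with each member of
  \<open>B\<close> means lying above all of them.\<close>

lemma mem_blocker_atoms:
  assumes "B \<subseteq> atoms P" "y \<in> blocker P B"
  shows "y \<in> carrier P" "B \<subseteq> atoms_below P y"
  using assms by (auto simp: blocker_def minimal_elements_def subset_iff atoms_below_atom)

section \<open>The double blocker identity implies (3)\<close>

lemma double_blocker_imp_le:
  assumes dbl: "\<And>A. antichain P A \<Longrightarrow> blocker P (blocker P A) = A"
    and x: "x \<in> carrier P" and y: "y \<in> carrier P"
    and sub: "atoms_below P x \<subseteq> atoms_below P y"
  shows "x \<sqsubseteq> y"
proof (cases "x = \<bottom>")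
  case False
  let ?E = "{z \<in> carrier P. \<forall>a\<in>atoms_below P x. atoms_below P z \<inter> atoms_below P a \<noteq> {}}"
  \<comment> \<open>The case split is made for this: \<open>{\<bottom>}\<close> is not an
    antichain.\<close>
  have "antichain P {x}" using x False by (auto simp: antichain_def)
  then have *: "minimal_elements P ?E = {x}"
    using dbl x by (metis blocker_def blocker_singleton)
  \<comment> \<open>Each atom below \<open>x\<close> is also below \<open>y\<close> and is itself
    the shared atom. The minimal element of \<open>?E\<close> below \<open>y\<close> can then only
    be \<open>x\<close>.\<close>
  have "y \<in> ?E"
    using y sub by (auto simp: atoms_below_atom atoms_below_def mem_atoms)
  then obtain m where "m \<in> minimal_elements P ?E" "m \<sqsubseteq> y"
    using minimal_element_below[of ?E y] by auto
  then show ?thesis using * by simp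
qed (use y in simp)

lemma double_blocker_imp_complement:
  assumes dbl: "\<And>A. antichain P A \<Longrightarrow> blocker P (blocker P A) = A"
    and x: "x \<in> carrier P"
  shows "\<exists>y\<in>carrier P. atoms P - atoms_below P x = atoms_below P y"
proof (cases "atoms P \<subseteq> atoms_below P x")
  case True
  \<comment> \<open>Here \<open>atoms P - atoms_below P x\<close> is empty, hence not an antichain;
    it is the atom set of \<bottom>.\<close>
  then show ?thesis using atoms_below_bottom by (intro bexI[of _ "\<bottom>"]) auto
next
  case False
  define B where "B = atoms P - atoms_below P x"
  have B: "B \<subseteq> atoms P" "B \<noteq> {}" using False by (auto simp: B_def)
  let ?E = "{z \<in> carrier P. \<forall>a\<in>blocker P B. atoms_below P z \<inter> atoms_below P a \<noteq> {}}"
  have *: "minimal_elements P ?E = B"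
    using dbl antichain_atoms[OF B] by (simp add: blocker_def)
  have "\<not> b \<sqsubseteq> x" if "b \<in> B" for b
    using that by (auto simp: B_def atoms_below_def)
  \<comment> \<open>Otherwise a minimal element of \<open>?E\<close>, that is a member of
    \<open>B\<close>, would lie below \<open>x\<close>.\<close>
  then have "x \<notin> ?E" using minimal_element_below[of ?E x] * by auto
  then obtain y where y: "y \<in> blocker P B" "atoms_below P x \<inter> atoms_below P y = {}"
    using x by blast
  have "atoms_below P y \<subseteq> B" using y(2) by (auto simp: B_def atoms_below_def)
  then show ?thesis
    using mem_blocker_atoms[OF B(1) y(1)] unfolding B_def by blast
qed

section \<open>Condition (3) implies the double blocker identity\<close>

lemma double_blocker:
  assumes le: "\<And>x y. \<lbrakk>x \<in> carrier P; y \<in> carrier P; atoms_below P x \<subseteq> atoms_below P y\<rbrakk> \<Longrightarrow> x \<sqsubseteq> y"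
    and compl: "\<And>x. x \<in> carrier P \<Longrightarrow>
      \<exists>y\<in>carrier P. atoms P - atoms_below P x = atoms_below P y"
    and A: "antichain P A"
  shows "blocker P (blocker P A) = A"
proof -
  let ?E = "\<lambda>A. {x \<in> carrier P. \<forall>a\<in>A. atoms_below P x \<inter> atoms_below P a \<noteq> {}}"
  have AP: "A \<subseteq> carrier P" using A by (simp add: antichain_def)
  have "minimal_elements P (?E (blocker P A)) = A"
  proof (rule minimal_elements_eqI)
    \<comment> \<open>Sharing an atom is a symmetric relation.\<close>
    show "A \<subseteq> ?E (blocker P A)"
      using AP by (auto simp: blocker_def minimal_elements_def Int_commute)
    show "b = c" if "b \<in> A" "c \<in> A" "b \<sqsubseteq> c" for b c
      using A that by (auto simp: antichain_def)
    fix x assume x: "x \<in> ?E (blocker P A)"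
    show "\<exists>a\<in>A. a \<sqsubseteq> x"
    proof (rule ccontr)
      assume "\<not> (\<exists>a\<in>A. a \<sqsubseteq> x)"
      then have not_sub: "\<not> atoms_below P a \<subseteq> atoms_below P x" if "a \<in> A" for a
        using le that AP x by blast
      obtain y where y: "y \<in> carrier P" "atoms P - atoms_below P x = atoms_below P y"
        using compl x by blast
      \<comment> \<open>By \<open>not_sub\<close>, \<open>a\<close> has an atom that is not below
        \<open>x\<close>; this atom is below \<open>y\<close>.\<close>
      have "atoms_below P y \<inter> atoms_below P a \<noteq> {}" if "a \<in> A" for a
        using not_sub[OF that] unfolding y(2)[symmetric] by (auto simp: atoms_below_def)
      then have "y \<in> ?E A" using y(1) by blast
      then obtain z where z: "z \<in> blocker P A" "z \<sqsubseteq> y"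
        unfolding blocker_def using minimal_element_below[of "?E A" y] by auto
      have "z \<in> carrier P" using z(1) by (simp add: blocker_def minimal_elements_def)
      then have "atoms_below P z \<subseteq> atoms_below P y" using atoms_below_mono z(2) y(1) by blast
      then have "atoms_below P x \<inter> atoms_below P z = {}" using y(2) by blast
      then show False using x z(1) by blast
    qed
  qed auto
  then show ?thesis by (simp add: blocker_def[of P "blocker P A"])
qed

section \<open>Well-complemented families and (3)\<close>

lemma iso_to_well_complemented_atoms_below:
  assumes le: "\<And>x y. \<lbrakk>x \<in> carrier P; y \<in> carrier P; atoms_below P x \<subseteq> atoms_below P y\<rbrakk> \<Longrightarrow> x \<sqsubseteq> y"
    and compl: "\<And>x. x \<in> carrier P \<Longrightarrow>
      \<exists>y\<in>carrier P. atoms P - atoms_below P x = atoms_below P y"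
  shows "iso_to_well_complemented P"
proof (rule iso_to_well_complementedI)
  let ?S = "atoms_below P ` carrier P"
  show "finite (atoms P)"
    by (rule finite_subset[OF _ finite_carrier]) (auto simp: mem_atoms)
  show "well_complemented (atoms P) ?S"
    unfolding well_complemented_def
  proof (intro conjI ballI)
    show "?S \<subseteq> Pow (atoms P)" by (auto simp: atoms_below_def)
    show "{} \<in> ?S" using atoms_below_bottom by (metis bottom_closed imageI)
    show "{a} \<in> ?S" if "a \<in> atoms P" for a
      using atoms_below_atom[OF that] that unfolding mem_atoms by (metis imageI)
    show "atoms P - s \<in> ?S" if "s \<in> ?S" for s
      using that compl by fastforce
  qed
  \<comment> \<open>Elements with the same atom set are below each other by
    \<open>le\<close>.\<close>
  have "inj_on (atoms_below P) (carrier P)"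
    by (intro inj_onI le_antisym le) auto
  moreover have "order_emb P (induced_subposet (boolean_lattice (atoms P)) ?S) (atoms_below P)"
    using weak_partial_order_boolean_subposet weak_partial_order_axioms le atoms_below_mono
    by (simp add: order_emb_def) (simp add: induced_subposet_def boolean_lattice_def, blast)
  ultimately show "order_isomorphic P (induced_subposet (boolean_lattice (atoms P)) ?S)"
    unfolding order_isomorphic_def
    by (intro exI[of _ "atoms_below P"])
       (simp add: bij_betw_def induced_subposet_def boolean_lattice_def)
qed

text \<open>Under \<open>f\<close> the atoms correspond to the singletons, so
  \<open>a \<sqsubseteq> x\<close> for the atom with \<open>f a = {v}\<close> becomes
  \<open>v \<in> f x\<close>. This turns (3) into a statement about subsets of
  \<open>V\<close>.\<close>

lemma atoms_below_via_well_complemented: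
  assumes S: "well_complemented V S"
    and f: "bij_betw f (carrier P) S"
    and emb: "\<And>x y. \<lbrakk>x \<in> carrier P; y \<in> carrier P\<rbrakk> \<Longrightarrow> f x \<subseteq> f y \<longleftrightarrow> x \<sqsubseteq> y"
    and x: "x \<in> carrier P"
  shows "atoms_below P x = {a \<in> carrier P. \<exists>v\<in>f x. f a = {v}}"
proof -
  have pre: "\<exists>z\<in>carrier P. f z = s" if "s \<in> S" for s
    using f that by (auto simp: bij_betw_def)
  have inj: "f y = f z \<longleftrightarrow> y = z" if "y \<in> carrier P" "z \<in> carrier P" for y z
    using f that by (auto simp: bij_betw_def inj_on_def)
  have fV: "f z \<subseteq> V" if "z \<in> carrier P" for z
    using f that S by (auto simp: bij_betw_def well_complemented_def)
  have empty: "f \<bottom> = {}"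
  proof -
    have "{} \<in> S" using S by (simp add: well_complemented_def)
    then obtain z where z: "z \<in> carrier P" "f z = {}" using pre by blast
    \<comment> \<open>As \<bottom> lies below \<open>z\<close>, its image is contained in the empty
      set.\<close>
    then show ?thesis using emb[of "\<bottom>" z] by simp
  qed
  have "a \<in> atoms P \<longleftrightarrow> (\<exists>v. f a = {v})" if a: "a \<in> carrier P" for a
  proof
    assume at: "a \<in> atoms P"
    then have "f a \<noteq> {}" using inj[OF a, of "\<bottom>"] empty by (simp add: mem_atoms)
    then obtain v where v: "v \<in> f a" by blast
    \<comment> \<open>The preimage of \<open>{v}\<close> lies below \<open>a\<close> and is not
      \<bottom>, so it must be the atom \<open>a\<close>.\<close>
    then have "{v} \<in> S" using fV[OF a] S by (auto simp: well_complemented_def)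
    then obtain z where z: "z \<in> carrier P" "f z = {v}" using pre by blast
    then have "z \<sqsubseteq> a" using emb[of z a] a v by simp
    then have "z = a" using at z empty by (auto simp: mem_atoms)
    then show "\<exists>v. f a = {v}" using z(2) by blast
  next
    assume "\<exists>v. f a = {v}"
    then obtain v where v: "f a = {v}" by blast
    have "z = \<bottom> \<or> z = a" if z: "z \<in> carrier P" "z \<sqsubseteq> a" for z
    proof -
      have "f z \<subseteq> {v}" using emb[of z a] a v z by simp
      then have "f z = f \<bottom> \<or> f z = f a" unfolding empty v by (rule subset_singletonD)
      then show ?thesis using inj[OF z(1) bottom_closed] inj[OF z(1) a] by blast
    qed
    moreover have "a \<noteq> \<bottom>" using v empty by auto
    ultimately show "a \<in> atoms P" using a by (simp add: mem_atoms)
  qed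
  moreover have "a \<in> carrier P" if "a \<in> atoms P" for a
    using that by (simp add: mem_atoms)
  moreover have "a \<sqsubseteq> x \<longleftrightarrow> f a \<subseteq> f x" if "a \<in> carrier P" for a
    using emb[OF that x] by blast
  ultimately have "a \<in> atoms_below P x \<longleftrightarrow> a \<in> carrier P \<and> (\<exists>v\<in>f x. f a = {v})" for a
    unfolding atoms_below_def by (metis (no_types, lifting) insert_subset empty_subsetI mem_Collect_eq)
  then show ?thesis by blast
qed

lemma iso_to_well_complementedD:
  assumes "iso_to_well_complemented P"
  shows "\<And>x y. \<lbrakk>x \<in> carrier P; y \<in> carrier P; atoms_below P x \<subseteq> atoms_below P y\<rbrakk> \<Longrightarrow> x \<sqsubseteq> y"
    and "\<And>x. x \<in> carrier P \<Longrightarrow>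
      \<exists>y\<in>carrier P. atoms P - atoms_below P x = atoms_below P y"
proof -
  obtain V :: "nat set" and S f where S: "well_complemented V S"
    and f: "bij_betw f (carrier P) S"
    and "order_emb P (induced_subposet (boolean_lattice V) S) f"
    using assms unfolding iso_to_well_complemented_def order_isomorphic_def
    by (auto simp: induced_subposet_def)
  then have emb: "f x \<subseteq> f y \<longleftrightarrow> x \<sqsubseteq> y" if "x \<in> carrier P" "y \<in> carrier P" for x y
    using that by (simp add: order_emb_def induced_subposet_def boolean_lattice_def)
  have below: "atoms_below P x = {a \<in> carrier P. \<exists>v\<in>f x. f a = {v}}" if "x \<in> carrier P" for x
    using atoms_below_via_well_complemented[OF S f _ that] emb by blast
  have pre: "\<exists>z\<in>carrier P. f z = s" if "s \<in> S" for s
    using f that by (auto simp: bij_betw_def)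
  have fS: "f z \<in> S" if "z \<in> carrier P" for z
    using f that by (auto simp: bij_betw_def)
  have fV: "f z \<subseteq> V" if "z \<in> carrier P" for z
    using fS[OF that] S by (auto simp: well_complemented_def)
  show "x \<sqsubseteq> y"
    if x: "x \<in> carrier P" and y: "y \<in> carrier P" and sub: "atoms_below P x \<subseteq> atoms_below P y"
    for x y
  proof -
    have "v \<in> f y" if v: "v \<in> f x" for v
    proof -
      \<comment> \<open>The atom \<open>a\<close> representing \<open>v\<close> is below
        \<open>x\<close>, hence below \<open>y\<close>, which carries \<open>v\<close> over to
        \<open>f y\<close>.\<close>
      have "{v} \<in> S" using S fV[OF x] v by (auto simp: well_complemented_def)
      then obtain a where a: "a \<in> carrier P" "f a = {v}" using pre by blast
      then have "a \<in> atoms_below P y" using sub v x below by blast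
      then show ?thesis using a(2) y below by auto
    qed
    then show ?thesis using emb[OF x y] by blast
  qed
  show "\<exists>y\<in>carrier P. atoms P - atoms_below P x = atoms_below P y"
    if x: "x \<in> carrier P" for x
  proof -
    have "V - f x \<in> S" using S fS[OF x] by (simp add: well_complemented_def)
    then obtain y where y: "y \<in> carrier P" "f y = V - f x" using pre by blast
    \<comment> \<open>Every atom is represented by some \<open>v\<close> in \<open>V\<close>; it is
      below \<open>x\<close> or below \<open>y\<close> according to whether \<open>v\<close> lies in
      \<open>f x\<close> or in \<open>V - f x\<close>.\<close>
    have "atoms P \<subseteq> {a \<in> carrier P. \<exists>v\<in>V. f a = {v}}"
    proof
      fix a assume at: "a \<in> atoms P"
      then have a: "a \<in> carrier P" by (simp add: mem_atoms)
      then have "a \<in> atoms_below P a" using atoms_below_atom[OF at] by simp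
      then show "a \<in> {a \<in> carrier P. \<exists>v\<in>V. f a = {v}}"
        using fV[OF a] unfolding below[OF a] by blast
    qed
    moreover have "atoms_below P y \<subseteq> atoms P" by (auto simp: atoms_below_def)
    ultimately have "atoms P - atoms_below P x = atoms_below P y"
      using y unfolding below[OF x] below[OF y(1)] by auto
    then show ?thesis using y(1) by blast
  qed
qed

end

theorem theorem2p7:
  fixes P :: "('a, 'b) gorder_scheme"
  assumes "finite_bounded_poset P"
  shows "((\<forall>A. antichain P A \<longrightarrow> blocker P (blocker P A) = A)
            \<longleftrightarrow> iso_to_well_complemented P)
    \<and> (iso_to_well_complemented P \<longleftrightarrow>
         (\<forall>x\<in>carrier P. \<forall>y\<in>carrier P.
            atoms_below P x \<subseteq> atoms_below P y \<longrightarrow> x \<sqsubseteq>\<^bsub>P\<^esub> y)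
         \<and> (\<forall>x\<in>carrier P. \<exists>y\<in>carrier P.
            atoms P - atoms_below P x = atoms_below P y))"
    (is "(?dbl \<longleftrightarrow> ?wc) \<and> (?wc \<longleftrightarrow> ?cond)")
proof -
  interpret finite_bounded_poset P by (rule assms)
  have "?dbl \<Longrightarrow> ?cond"
    using double_blocker_imp_le double_blocker_imp_complement by simp
  moreover have "?cond \<Longrightarrow> ?dbl" using double_blocker by simp
  moreover have "?cond \<Longrightarrow> ?wc" using iso_to_well_complemented_atoms_below by simp
  moreover have "?wc \<Longrightarrow> ?cond" using iso_to_well_complementedD by simp
  ultimately show ?thesis by blast
qed

end
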